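(* Let $N\ge 3$ be an odd integer. Then the polynomial \[ F(z)=\sum_{j=1}^{(N-1)/2}(-1)^{j-1}\left(1-2\,\frac{j-1}{N-2}\right)\left(\frac{N-j}{N-1}z^j+\frac{j}{N-1}z^{N-j}\right) \] is univalent (i.e. injective) in the open unit disk $\mathbb{D}=\{z\in\mathbb{C}:|z|<1\}$. *)

theory Defs
  imports "HOL-Analysis.Analysis"
begin

definition F :: "nat \<Rightarrow> complex \<Rightarrow> complex" where
  "F N z = (\<Sum>j = 1..(N - 1) div 2.
     (-1) ^ (j - 1) * (1 - 2 * ((of_nat j - 1) / (of_nat N - 2))) *
     ((of_nat N - of_nat j) / (of_nat N - 1) * z ^ j
      + of_nat j / (of_nat N - 1) * z ^ (N - j)))"

end

theory Submission
  imports Defs "HOL-Complex_Analysis.Conformal_Mappings"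
begin

text \<open>
  Up to constants, \<open>F N z\<close> is \<open>G (- z)\<close> with \<open>G w = (\<Sum>k<N. (N - k) (N - 2 k) w^k)\<close>. The coefficients
  of \<open>w G'\<close> are cubic in \<open>k\<close>, so \<open>(1 - w)^4 G' = Q* - w^N Q\<close> with a quadratic \<open>Q\<close> whose roots lie
  outside the closed disk, \<open>Q* w = w^2 Q (1 / w)\<close> being its reversal. On the unit circle
  \<open>Q* = w^2 cnj Q\<close> and \<open>(1 - w)^4 = w^2 |1 - w|^4\<close>, hence
  \<open>Q G' = (|Q|^2 - w^(N - 2) Q^2) / |1 - w|^4\<close> has nonnegative real part there, and positive real part
  inside the disk by the maximum principle. As \<open>1 / Q\<close> is the derivative of a convex map,
  \<open>G\<close> is close-to-convex and thus univalent.
\<close>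

section \<open>Univalence of close-to-convex functions on the disk\<close>

text \<open>If two points had equal values, the mean value theorem along the segment joining them,
  applied to \<open>f\<close> divided by their difference, would produce a point with
  \<open>Re (f' u) = 0\<close>.\<close>

lemma noshiro_warschawski:
  fixes f :: "complex \<Rightarrow> complex"
  assumes "convex S"
    and der: "\<And>z. z \<in> S \<Longrightarrow> (f has_field_derivative f' z) (at z)"
    and pos: "\<And>z. z \<in> S \<Longrightarrow> Re (f' z) > 0"
  shows "inj_on f S"
proof (rule inj_onI, rule ccontr)
  fix w z assume wz: "w \<in> S" "z \<in> S" "f w = f z" "w \<noteq> z"
  then have seg: "closed_segment w z \<subseteq> S"
    using \<open>convex S\<close> by (simp add: closed_segment_subset)
  have "((\<lambda>u. f u / (z - w)) has_field_derivative f' u / (z - w)) (at u)"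
    if "u \<in> closed_segment w z" for u
    using that seg der by (intro DERIV_cdivide) auto
  from complex_mvt_line[OF this] obtain u where "u \<in> closed_segment w z"
    and "Re (f z / (z - w)) - Re (f w / (z - w)) = Re (f' u / (z - w) * (z - w))"
    by blast
  with wz have "Re (f' u) = 0" by simp
  with pos seg \<open>u \<in> closed_segment w z\<close> show False by fastforce
qed

text \<open>This is a sublevel set of a convex function of \<open>Re z\<close> plus
  \<open>- K * cos (Im z)\<close>, and the latter is convex where the cosine is nonnegative. Regions
  of this shape arise as logarithmic images of the disk.\<close>

lemma convex_exp_less_cos:
  fixes A B K :: real
  assumes "A \<ge> 0" "B \<ge> 0" "K \<ge> 0"
  shows "convex {z. \<bar>Im z\<bar> < pi/2 \<and> A * exp (- Re z) + B * exp (Re z) < K * cos (Im z)}"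
proof -
  have e1: "convex_on UNIV (\<lambda>x::real. A * exp (-x) + B * exp x)"
    by (rule f''_ge0_imp_convex[where f' = "\<lambda>x. - A * exp (-x) + B * exp x"
          and f'' = "\<lambda>x. A * exp (-x) + B * exp x"])
      (use assms in \<open>auto intro!: derivative_eq_intros\<close>)
  have e2: "convex_on {-(pi/2)<..<pi/2} (\<lambda>y::real. - (K * cos y))"
    by (rule f''_ge0_imp_convex[where f' = "\<lambda>y. K * sin y" and f'' = "\<lambda>y. K * cos y"])
      (use assms in \<open>auto intro!: derivative_eq_intros mult_nonneg_nonneg cos_ge_zero\<close>)
  show ?thesis
  proof (rule convexI)
    fix z w :: complex and s t :: real
    assume z: "z \<in> {z. \<bar>Im z\<bar> < pi/2 \<and> A * exp (- Re z) + B * exp (Re z) < K * cos (Im z)}"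
      and w: "w \<in> {z. \<bar>Im z\<bar> < pi/2 \<and> A * exp (- Re z) + B * exp (Re z) < K * cos (Im z)}"
      and st: "s \<ge> 0" "t \<ge> 0" "s + t = 1"
    have I: "Im z \<in> {-(pi/2)<..<pi/2}" "Im w \<in> {-(pi/2)<..<pi/2}"
      using z w by auto
    then have "s * Im z + t * Im w \<in> {-(pi/2)<..<pi/2}"
      using convexD[OF convex_real_interval(8)[of "-(pi/2)" "pi/2"], of "Im z" "Im w" s t] st by simp
    then have im: "\<bar>s * Im z + t * Im w\<bar> < pi/2" by (simp only: abs_less_iff greaterThanLessThan_iff minus_less_iff)
    define p where "p x = A * exp (-x) + B * exp x" for x :: real
    have 1: "p (s * Re z + t * Re w) \<le> s * p (Re z) + t * p (Re w)"
      using convex_onD[OF e1, of t "Re z" "Re w"] st unfolding p_def by (simp add: eq_diff_eq[symmetric])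
    have 2: "- (K * cos (s * Im z + t * Im w)) \<le> s * (- (K * cos (Im z))) + t * (- (K * cos (Im w)))"
      using convex_onD[OF e2, of t "Im z" "Im w", OF _ _ I] st by (simp add: eq_diff_eq[symmetric])
    have "p (Re z) - K * cos (Im z) < 0" "p (Re w) - K * cos (Im w) < 0"
      using z w by (auto simp: p_def)
    then have "s * (p (Re z) - K * cos (Im z)) + t * (p (Re w) - K * cos (Im w)) < 0"
      using st by (smt (verit, best) mult_nonneg_nonpos mult_pos_neg)
    then have "p (s * Re z + t * Re w) < K * cos (s * Im z + t * Im w)"
      using 1 2 by (simp add: algebra_simps)
    with im show "s *\<^sub>R z + t *\<^sub>R w \<in> {z. \<bar>Im z\<bar> < pi/2 \<and> A * exp (- Re z) + B * exp (Re z) < K * cos (Im z)}"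
      by (simp add: p_def)
  qed
qed

text \<open>The antiderivative of \<open>1 / ((1 - a w) (1 - b w))\<close> is a multiple of
  \<open>Ln ((1 - b w) / (1 - a w))\<close> and maps the disk onto a convex region; \<open>\<phi>\<close> is its inverse,
  normalised by the rotation \<open>u\<close> so that the region is symmetric about the real axis.\<close>

lemma inj_on_disk_close_to_convex:
  fixes a b :: complex
  assumes ab: "norm a \<le> 1" "norm b \<le> 1" "a \<noteq> b"
    and der: "\<And>w. w \<in> ball 0 1 \<Longrightarrow> (f has_field_derivative f' w) (at w)"
    and pos: "\<And>w. w \<in> ball 0 1 \<Longrightarrow> Re ((1 - a * w) * (1 - b * w) * f' w) > 0"
  shows "inj_on f (ball 0 1)"
proof -
  define d where "d = 1 - a * cnj b"
  have "d \<noteq> 0"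
  proof
    assume "d = 0"
    then have 1: "a * cnj b = 1" by (simp add: d_def)
    then have "norm a * norm b = 1" by (metis complex_mod_cnj norm_mult norm_one)
    with ab have "norm b = 1"
      by (smt (verit, ccfv_threshold) mult_left_le mult_left_le_one_le norm_ge_zero)
    then have "cnj b * b = 1" by (metis complex_norm_square mult.commute of_real_1 one_power2)
    with 1 have "a = b" by (metis mult.assoc mult.commute mult_1)
    with ab show False by simp
  qed
  \<comment> \<open>The unimodular factor that rotates \<open>d\<close> onto the positive real axis,
    so that only \<open>Re m\<close> enters the identity \<open>key\<close>.\<close>
  define u where "u = of_real (norm d) / d"
  have du: "d * u = of_real (norm d)" using \<open>d \<noteq> 0\<close> by (simp add: u_def)
  have nu: "norm u = 1" using \<open>d \<noteq> 0\<close> by (simp add: u_def norm_divide)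
  then have u0: "u \<noteq> 0" by auto
  have key: "(norm (b - a * (u * m)))^2 - (norm (1 - u * m))^2
      = 2 * norm d * Re m - (1 - (norm b)^2) - (1 - (norm a)^2) * (norm m)^2" for m
  proof -
    have sq: "(norm (x - y))^2 = (norm x)^2 + (norm y)^2 - 2 * Re (y * cnj x)" for x y :: complex
      by (simp add: cmod_power2 power2_diff algebra_simps)
    have "(norm (b - a * (u * m)))^2 = (norm b)^2 + (norm a)^2 * (norm m)^2 - 2 * Re (a * cnj b * (u * m))"
      unfolding sq using nu by (simp add: norm_mult power_mult_distrib mult_ac)
    moreover have "(norm (1 - u * m))^2 = 1 + (norm m)^2 - 2 * Re (u * m)"
      unfolding sq using nu by (simp add: norm_mult)
    moreover have "Re (d * (u * m)) = norm d * Re m"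
      by (metis du mult.assoc Re_complex_of_real Im_complex_of_real times_complex.sel(1) mult_zero_left diff_zero)
    then have "Re (u * m) - Re (a * cnj b * (u * m)) = norm d * Re m"
      by (simp add: d_def algebra_simps)
    ultimately show ?thesis by (simp add: algebra_simps)
  qed
  \<comment> \<open>For \<open>m = exp z\<close>, dividing \<open>key\<close> by
    \<open>exp (Re z)\<close> turns membership of \<open>\<phi> z\<close> in the disk into this
    inequality. It is invariant under shifts by \<open>2 * pi * \<i>\<close>; the strip selects one
    branch of the logarithm.\<close>
  define S where "S = {z. \<bar>Im z\<bar> < pi/2 \<and>
    (1 - (norm b)^2) * exp (- Re z) + (1 - (norm a)^2) * exp (Re z) < 2 * norm d * cos (Im z)}"
  have "convex S"
    unfolding S_def using ab by (intro convex_exp_less_cos) (auto simp: abs_square_le_1)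
  have disk: "norm (1 - u * exp z) < norm (b - a * (u * exp z)) \<longleftrightarrow>
     (1 - (norm b)^2) * exp (- Re z) + (1 - (norm a)^2) * exp (Re z) < 2 * norm d * cos (Im z)" for z
  proof -
    have "norm (1 - u * exp z) < norm (b - a * (u * exp z)) \<longleftrightarrow>
       0 < (norm (b - a * (u * exp z)))^2 - (norm (1 - u * exp z))^2"
      by (auto intro: power_strict_mono power2_less_imp_less)
    also have "\<dots> \<longleftrightarrow> 0 < exp (Re z) * (2 * norm d * cos (Im z) - (1 - (norm b)^2) * exp (- Re z)
        - (1 - (norm a)^2) * exp (Re z))"
      unfolding key by (simp add: Re_exp algebra_simps power2_eq_square exp_minus)
    finally show ?thesis by (simp add: zero_less_mult_iff) linarith
  qed
  define \<phi> where "\<phi> z = (1 - u * exp z) / (b - a * (u * exp z))" for z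
  have den: "b - a * (u * exp z) \<noteq> 0" if "z \<in> S" for z
    using that disk[of z] unfolding S_def by (auto simp del: right_minus_eq)
  have \<phi>_disk: "\<phi> z \<in> ball 0 1" if "z \<in> S" for z
    using that disk[of z] den[OF that] unfolding S_def \<phi>_def by (simp add: norm_divide)
  have \<phi>_surj: "\<exists>z\<in>S. \<phi> z = w" if "w \<in> ball 0 1" for w
  proof -
    have w: "norm w < 1" using that by simp
    have aw: "1 - c * w \<noteq> 0" if "norm c \<le> 1" for c
    proof
      assume "1 - c * w = 0"
      then have "norm c * norm w = 1" by (metis eq_iff_diff_eq_0 norm_mult norm_one)
      with that w show False
        by (smt (verit, ccfv_threshold) mult_left_le_one_le norm_ge_zero)
    qed
    note aw = aw[OF ab(1)] aw[OF ab(2)]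
    \<comment> \<open>The solution of \<open>(1 - u * m) / (b - a * (u * m)) = w\<close>. By
      \<open>key\<close> its real part is positive, so \<open>Ln m\<close> falls into the
      strip.\<close>
    define m where "m = (1 - b * w) / ((1 - a * w) * u)"
    have m0: "m \<noteq> 0" using aw u0 by (simp add: m_def)
    have um: "u * m = (1 - b * w) / (1 - a * w)" using u0 by (simp add: m_def)
    have 1: "1 - u * m = w * ((b - a) / (1 - a * w))"
      unfolding um using aw by (simp add: field_simps)
    have 2: "b - a * (u * m) = (b - a) / (1 - a * w)"
      unfolding um using aw by (simp add: field_simps)
    have n0: "(b - a) / (1 - a * w) \<noteq> 0" using aw ab by simp
    have lt: "norm (1 - u * m) < norm (b - a * (u * m))"
      unfolding 1 2 norm_mult[of w] using w n0 by (metis mult_less_cancel_right2 zero_less_norm_iff norm_ge_zero not_less)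
    then have "(norm (1 - u * m))^2 < (norm (b - a * (u * m)))^2" by (simp add: power_strict_mono)
    moreover have "(1 - (norm b)^2) + (1 - (norm a)^2) * (norm m)^2 \<ge> 0"
      using ab by (intro add_nonneg_nonneg mult_nonneg_nonneg) (auto simp: abs_square_le_1)
    ultimately have "2 * norm d * Re m > 0" using key[of m] by linarith
    then have "Re m > 0" by (simp add: zero_less_mult_iff)
    then have "\<bar>Im (Ln m)\<bar> < pi/2" by (rule Re_Ln_pos_lt_imp)
    moreover have e: "exp (Ln m) = m" using m0 by simp
    ultimately have "Ln m \<in> S" using lt disk[of "Ln m"] unfolding S_def by simp
    moreover have "\<phi> (Ln m) = w" unfolding \<phi>_def e 1 2 using aw ab by simp
    ultimately show ?thesis by blast
  qed
  define \<psi> where "\<psi> z = (1 - a * \<phi> z) * (1 - b * \<phi> z)" for z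
  have \<phi>_der: "(\<phi> has_field_derivative \<psi> z / (a - b)) (at z)" if "z \<in> S" for z
  proof -
    define e where "e = u * exp z"
    have d0: "b - a * e \<noteq> 0" using den[OF that] by (simp add: e_def)
    have "(\<phi> has_field_derivative
        ((- e) * (b - a * e) - (1 - e) * (- (a * e))) / ((b - a * e) * (b - a * e))) (at z)"
      unfolding \<phi>_def e_def using d0[unfolded e_def]
      by (auto intro!: derivative_eq_intros)
    moreover have "\<psi> z / (a - b) = ((- e) * (b - a * e) - (1 - e) * (- (a * e))) / ((b - a * e) * (b - a * e))"
    proof -
      have "1 - a * \<phi> z = (b - a) / (b - a * e)" "1 - b * \<phi> z = (b - a) * e / (b - a * e)"
        unfolding \<phi>_def e_def[symmetric] using d0 by (auto simp: field_simps)
      then show ?thesis unfolding \<psi>_def using d0 ab by (simp add: divide_simps) algebra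
    qed
    ultimately show ?thesis by simp
  qed
  \<comment> \<open>The factor \<open>a - b\<close> cancels the denominator of the derivative of
    \<open>\<phi>\<close>, leaving exactly the expression whose real part is assumed
    positive.\<close>
  have "inj_on (\<lambda>z. (a - b) * f (\<phi> z)) S"
  proof (rule noshiro_warschawski[OF \<open>convex S\<close>, where f' = "\<lambda>z. \<psi> z * f' (\<phi> z)"])
    fix z assume z: "z \<in> S"
    have "((\<lambda>z. (a - b) * f (\<phi> z)) has_field_derivative (a - b) * (f' (\<phi> z) * (\<psi> z / (a - b)))) (at z)"
      by (intro DERIV_cmult DERIV_chain2[OF der[OF \<phi>_disk[OF z]] \<phi>_der[OF z]])
    then show "((\<lambda>z. (a - b) * f (\<phi> z)) has_field_derivative \<psi> z * f' (\<phi> z)) (at z)"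
      using ab by (simp add: mult.commute)
    show "Re (\<psi> z * f' (\<phi> z)) > 0" unfolding \<psi>_def using pos[OF \<phi>_disk[OF z]] .
  qed
  then show ?thesis
    using \<phi>_surj unfolding inj_on_def by metis
qed

section \<open>Positive real part: from the circle to the disk, and the cubic sum on the
  circle\<close>

lemma Re_pos_disk_from_circle:
  assumes hol: "p holomorphic_on ball 0 1" and cont: "continuous_on (cball 0 1) p"
    and bd: "\<And>w. norm w = 1 \<Longrightarrow> Re (p w) \<ge> 0"
    and p0: "Re (p 0) > 0" and w: "w \<in> ball 0 1"
  shows "Re (p w) > 0"
proof (rule ccontr)
  assume neg: "\<not> Re (p w) > 0"
  have ge: "Re (- p z) \<le> 0" if "z \<in> ball 0 1" for z
    by (rule maximum_real_frontier[of _ "ball 0 1"])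
       (use hol cont bd that in \<open>auto intro!: holomorphic_intros continuous_intros\<close>)
  \<comment> \<open>The modulus \<open>exp (- Re (p z))\<close> is at most 1 and attains 1 at
    \<open>w\<close>, where \<open>Re (p w)\<close> must be 0.\<close>
  have "(\<lambda>z. exp (- p z)) constant_on ball 0 1"
    by (rule maximum_modulus_principle[where U = "ball 0 1" and \<xi> = w])
       (use hol w ge neg in \<open>auto intro!: holomorphic_intros\<close>, smt (verit) ge mem_ball_0 uminus_complex.sel(1))
  then have "exp (- p w) = exp (- p 0)"
    using w unfolding constant_on_def by fastforce
  then have "Re (p w) = Re (p 0)"
    by (metis add.inverse_inverse exp_inj_iff norm_exp_eq_Re uminus_complex.sel(1))
  with p0 neg show False by simp
qed

text \<open>Needed with \<open>x = of_nat n\<close>, where the terms \<open>k\<close> and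
  \<open>n - k\<close> cancel and the right side vanishes; keeping \<open>x\<close> free lets the
  induction go through.\<close>

lemma sum_antisym_cubic:
  fixes x :: complex
  shows "2 * (\<Sum>k<n. of_nat k * (x - of_nat k) * (x - 2 * of_nat k))
    = of_nat n * (of_nat n - 1) * (x - of_nat n) * (x - of_nat n + 1)"
  by (induction n) (simp_all add: algebra_simps power2_eq_square)

text \<open>Fourfold summation by parts: \<open>R\<close> satisfies \<open>R t - w R (t + 1) = (1 - w)^4 c t\<close>
  because \<open>c\<close> is a cubic.\<close>

lemma sum_antisym_cubic_power:
  fixes x w :: complex
  defines "c \<equiv> \<lambda>t. t * (x - t) * (x - 2 * t)"
  defines "R \<equiv> \<lambda>t. c t * (1 - w)^3 + (c (t + 1) - c t) * w * (1 - w)^2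
    + (c (t + 2) - 2 * c (t + 1) + c t) * w^2 * (1 - w)
    + (c (t + 3) - 3 * c (t + 2) + 3 * c (t + 1) - c t) * w^3"
  shows "(1 - w)^4 * (\<Sum>k<n. c (of_nat k) * w^k) = R 0 - w^n * R (of_nat n)"
proof (induction n)
  case (Suc n)
  have "R t - w * R (t + 1) = (1 - w)^4 * c t" for t
    unfolding R_def c_def by algebra
  from this[of "of_nat n"]
  have "w^n * (R (of_nat n) - w * R (of_nat n + 1)) = (1 - w)^4 * (c (of_nat n) * w^n)" by simp
  with Suc show ?case by (simp add: algebra_simps)
qed simp

lemma Re_quadratic_sum_nonneg:
  fixes w :: complex and N :: nat
  defines "Q \<equiv> (of_nat N + 1) * (of_nat N + 2) - 2 * ((of_nat N)^2 - 4) * w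
    + (of_nat N - 1) * (of_nat N - 2) * w^2"
  defines "H \<equiv> \<Sum>k<N. of_nat k * (of_nat N - of_nat k) * (of_nat N - 2 * of_nat k) * w^(k - 1)"
  assumes "N \<ge> 2" and w: "norm w = 1"
  shows "Re (Q * H) \<ge> 0"
\<comment> \<open>The closed form carries the factor \<open>(1 - w)^4\<close>, so
  \<open>w = 1\<close> is settled separately by the vanishing of the sum.\<close>
proof (cases "w = 1")
  case True
  have "2 * H = 0" using sum_antisym_cubic[of N "of_nat N"] True by (simp add: H_def)
  then show ?thesis by simp
next
  case False
  have w0: "w \<noteq> 0" using w by auto
  have cw: "w * cnj w = 1" using w by (simp add: complex_norm_square[symmetric])
  define Q' where "Q' = (of_nat N - 1) * (of_nat N - 2) - 2 * ((of_nat N)^2 - 4) * w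
    + (of_nat N + 1) * (of_nat N + 2) * w^2"
  have Q': "Q' = w^2 * cnj Q"
  proof -
    have "w^2 * cnj Q = (of_nat N + 1) * (of_nat N + 2) * w^2 - 2 * ((of_nat N)^2 - 4) * w * (w * cnj w)
        + (of_nat N - 1) * (of_nat N - 2) * (w * cnj w)^2"
      unfolding Q_def by (simp add: algebra_simps power2_eq_square)
    then show ?thesis unfolding cw Q'_def by (simp add: algebra_simps)
  qed
  have wH: "w * H = (\<Sum>k<N. of_nat k * (of_nat N - of_nat k) * (of_nat N - 2 * of_nat k) * w^k)"
    unfolding H_def sum_distrib_left
    by (intro sum.cong refl) (auto simp: power_eq_if)
  \<comment> \<open>The boundary terms of the fourfold summation by parts, at \<open>0\<close> and
    at \<open>N\<close>, are \<open>w * Q'\<close> and \<open>w * Q\<close>.\<close>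
  have "(1 - w)^4 * (w * H) = w * (Q' - w^N * Q)"
    unfolding wH sum_antisym_cubic_power Q_def Q'_def by algebra
  then have 1: "(1 - w)^4 * H = Q' - w^N * Q"
    using w0 by (metis mult.left_commute mult_left_cancel)
  define r where "r = (norm (1 - w))^2"
  have r: "(1 - w) * (1 - cnj w) = of_real r"
    unfolding r_def by (simp only: complex_norm_square) simp
  have "(1 - w)^2 = - ((1 - w) * (w - w * cnj w))"
    unfolding cw by (simp add: power2_eq_square algebra_simps)
  also have "\<dots> = - w * of_real r"
    unfolding r[symmetric] by (simp add: algebra_simps)
  finally have "(1 - w)^2 = - w * of_real r" .
  then have 2: "(1 - w)^4 = w^2 * of_real (r^2)"
    using power_mult[of "1 - w" 2 2] by (simp add: power_mult_distrib)
  have N: "w^N = w^2 * w^(N - 2)" using \<open>N \<ge> 2\<close> by (simp only: power_add[symmetric] le_add_diff_inverse)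
  have "w^2 * (of_real (r^2) * (Q * H)) = w^2 * (cnj Q * Q - w^(N - 2) * Q^2)"
    using arg_cong[OF 1, of "\<lambda>t. Q * t"] unfolding 2 N Q' by (simp add: algebra_simps power2_eq_square)
  then have "of_real (r^2) * (Q * H) = cnj Q * Q - w^(N - 2) * Q^2" using w0 by simp
  also have "cnj Q * Q = of_real ((norm Q)^2)" by (simp only: complex_norm_square mult.commute)
  finally have 3: "of_real (r^2) * (Q * H) = of_real ((norm Q)^2) - w^(N - 2) * Q^2" .
  have "Re (w^(N - 2) * Q^2) \<le> norm (w^(N - 2) * Q^2)" by (rule complex_Re_le_cmod)
  also have "\<dots> = (norm Q)^2" using w by (simp add: norm_mult norm_power)
  finally have "Re (of_real (r^2) * (Q * H)) \<ge> 0" unfolding 3 by simp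
  then have "r^2 * Re (Q * H) \<ge> 0" by (simp only: Re_complex_of_real times_complex.sel Im_complex_of_real mult_zero_left diff_zero)
  moreover have "r^2 > 0" using False by (simp add: r_def)
  ultimately show ?thesis by (simp add: zero_le_mult_iff)
qed

section \<open>Univalence of the antisymmetric sum\<close>

lemma inj_on_antisym_sum:
  assumes "N \<ge> 3"
  shows "inj_on (\<lambda>w::complex. \<Sum>k<N. (of_nat N - of_nat k) * (of_nat N - 2 * of_nat k) * w^k) (ball 0 1)"
proof -
  define Q :: "complex \<Rightarrow> complex" where
    "Q w = (of_nat N + 1) * (of_nat N + 2) - 2 * ((of_nat N)^2 - 4) * w
      + (of_nat N - 1) * (of_nat N - 2) * w^2" for w
  define H :: "complex \<Rightarrow> complex" where
    "H w = (\<Sum>k<N. of_nat k * (of_nat N - of_nat k) * (of_nat N - 2 * of_nat k) * w^(k - 1))" for w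
  define n where "n = real N"
  have n: "n \<ge> 3" using assms by (simp add: n_def)
  define D where "D = (n + 1) * (n + 2)"
  \<comment> \<open>The values of \<open>x\<close> and \<open>y\<close> come from matching
    coefficients in \<open>Q w = D * (1 - 2 * x * w + (x^2 + y^2) * w^2)\<close>;
    \<open>n^2 > 4\<close> makes \<open>y\<close> nonzero, which separates \<open>a\<close> from
    \<open>cnj a\<close>.\<close>
  define x where "x = (n^2 - 4) / D"
  define y where "y = sqrt (3 * (n^2 - 4)) / D"
  define a where "a = Complex x y"
  \<comment> \<open>\<open>a\<close> and \<open>cnj a\<close> are the reciprocals of the roots of \<open>Q\<close>.\<close>
  have n2: "n^2 - 4 > 0" using n power_mono[of 3 n 2] by simp
  have D0: "D > 0" using n by (simp add: D_def)
  have "x^2 + y^2 = ((n^2 - 4)^2 + 3 * (n^2 - 4)) / D^2"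
    using n2 by (simp add: x_def y_def power_divide add_divide_distrib)
  also have "(n^2 - 4)^2 + 3 * (n^2 - 4) = (n - 1) * (n - 2) * D"
    unfolding D_def by algebra
  finally have xy: "x^2 + y^2 = (n - 1) * (n - 2) / D" by (simp add: power2_eq_square)
  have na: "norm a \<le> 1"
  proof -
    have "(n - 1) * (n - 2) \<le> D" using n unfolding D_def by (simp add: algebra_simps)
    then have "x^2 + y^2 \<le> 1" unfolding xy using D0 by simp
    then show ?thesis by (simp add: a_def cmod_def)
  qed
  have ne: "a \<noteq> cnj a" using n2 D0 by (simp add: a_def y_def complex_eq_iff)
  have Q: "Q w = of_real D * ((1 - a * w) * (1 - cnj a * w))" for w
  proof -
    have s: "a + cnj a = of_real (2 * x)" by (simp add: a_def complex_eq_iff)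
    have p: "a * cnj a = of_real (x^2 + y^2)"
      by (simp add: a_def complex_eq_iff power2_eq_square)
    have "of_real D * ((1 - a * w) * (1 - cnj a * w))
        = of_real D - of_real D * (a + cnj a) * w + of_real D * (a * cnj a) * w^2"
      by (simp add: algebra_simps power2_eq_square)
    also have "\<dots> = of_real D - of_real (D * (2 * x)) * w + of_real (D * (x^2 + y^2)) * w^2"
      unfolding s p by simp
    also have "D * (2 * x) = 2 * (n^2 - 4)" using D0 by (simp add: x_def)
    also have "D * (x^2 + y^2) = (n - 1) * (n - 2)" unfolding xy using D0 by simp
    finally show ?thesis by (simp add: Q_def D_def n_def)
  qed
  have H0: "H 0 = of_real ((n - 1) * (n - 2))"
  proof -
    \<comment> \<open>Truncated subtraction makes \<open>0^(k - 1)\<close> equal to 1 at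
      \<open>k = 0\<close> too, but there the factor \<open>of_nat k\<close> vanishes.\<close>
    have "H 0 = (\<Sum>k<N. if k = 1 then of_nat k * (of_nat N - of_nat k) * (of_nat N - 2 * of_nat k) else 0)"
      unfolding H_def by (intro sum.cong refl) (auto simp: power_0_left)
    also have "\<dots> = (of_nat N - 1) * (of_nat N - 2)" using assms by (simp add: sum.delta)
    finally show ?thesis by (simp add: n_def)
  qed
  have "Re (Q w * H w) > 0" if "w \<in> ball 0 1" for w
  proof (rule Re_pos_disk_from_circle[OF _ _ _ _ that])
    show "Re (Q w * H w) \<ge> 0" if "norm w = 1" for w
      using Re_quadratic_sum_nonneg[of N w] that assms by (simp add: Q_def H_def)
    have "Q 0 * H 0 = of_real (D * ((n - 1) * (n - 2)))" unfolding Q H0 by simp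
    then show "Re (Q 0 * H 0) > 0" using D0 n by (simp only: Re_complex_of_real) simp
  qed (auto simp: Q_def H_def intro!: holomorphic_intros continuous_intros)
  moreover have "Re (Q w * H w) = D * Re ((1 - a * w) * (1 - cnj a * w) * H w)" for w
    unfolding Q by (simp only: mult.assoc Re_complex_of_real times_complex.sel(1)[of "of_real D"] Im_complex_of_real mult_zero_left diff_zero)
  ultimately have pos: "Re ((1 - a * w) * (1 - cnj a * w) * H w) > 0" if "w \<in> ball 0 1" for w
    using that D0 by (metis zero_less_mult_pos)
  show ?thesis
  proof (rule inj_on_disk_close_to_convex[OF na _ ne _ pos])
    show "norm (cnj a) \<le> 1" using na by simp
    show "((\<lambda>w. \<Sum>k<N. (of_nat N - of_nat k) * (of_nat N - 2 * of_nat k) * w^k) has_field_derivative H w) (at w)" for w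
      unfolding H_def by (auto intro!: derivative_eq_intros sum.cong)
  qed
qed

section \<open>Rewriting \<open>F\<close> as the antisymmetric sum\<close>

lemma sum_pair_reflect:
  fixes g :: "nat \<Rightarrow> 'a::comm_monoid_add"
  shows "(\<Sum>j = 1..m. g j + g (2 * m + 1 - j)) = (\<Sum>k = 1..2 * m. g k)"
proof -
  have "(\<Sum>j = 1..m. g (2 * m + 1 - j)) = (\<Sum>k = m + 1..2 * m. g k)"
    by (rule sum.reindex_bij_witness[where i = "\<lambda>k. 2 * m + 1 - k" and j = "\<lambda>k. 2 * m + 1 - k"]) auto
  moreover have "(\<Sum>k = 1..2 * m. g k) = (\<Sum>k = 1..m. g k) + (\<Sum>k = m + 1..2 * m. g k)"
    using sum.ub_add_nat[of 1 m g m] by (simp add: mult_2)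
  ultimately show ?thesis by (simp add: sum.distrib)
qed

text \<open>Replacing \<open>j\<close> by \<open>N - j\<close> flips the sign of
  \<open>N - 2 * j\<close>, and, as \<open>N\<close> is odd, also that of \<open>(-1)^j\<close>;
  hence the two powers in each summand of \<open>F\<close> are the terms \<open>j\<close> and
  \<open>N - j\<close> of one sum. The term \<open>k = 0\<close>, equal to \<open>N^2\<close>, does
  not occur in \<open>F\<close> and is subtracted.\<close>

lemma F_eq_antisym_sum:
  assumes "N \<ge> 3" "odd N"
  shows "F N z = ((of_nat N)^2 - (\<Sum>k<N. (of_nat N - of_nat k) * (of_nat N - 2 * of_nat k) * (- z)^k))
    / ((of_nat N - 1) * (of_nat N - 2))"
proof -
  obtain m where m: "N = 2 * m + 1" using \<open>odd N\<close> by (elim oddE)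
  define g :: "nat \<Rightarrow> complex" where
    "g k = (of_nat N - of_nat k) * (of_nat N - 2 * of_nat k) * (- z)^k" for k
  define C :: complex where "C = (of_nat N - 1) * (of_nat N - 2)"
  have N1: "of_nat N - 1 \<noteq> (0::complex)" "of_nat N - 2 \<noteq> (0::complex)"
    using assms of_nat_eq_iff[where 'a = complex, of N 1] of_nat_eq_iff[where 'a = complex, of N 2] by auto
  have summand: "(-1) ^ (j - 1) * (1 - 2 * ((of_nat j - 1) / (of_nat N - 2))) *
     ((of_nat N - of_nat j) / (of_nat N - 1) * z ^ j + of_nat j / (of_nat N - 1) * z ^ (N - j))
     = - (g j + g (2 * m + 1 - j)) / C" if "j \<in> {1..m}" for j
  proof -
    have j: "j \<ge> 1" "j \<le> N" using that m by auto
    have s1: "(-1) ^ (j - 1) = - ((-1) ^ j :: complex)" using j by (cases j) auto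
    have "even (N - j) \<longleftrightarrow> odd j" using j \<open>odd N\<close> by simp
    then have s2: "(-1) ^ (N - j) = - ((-1) ^ j :: complex)" by (simp add: minus_one_power_iff)
    have g2: "g (N - j) = of_nat j * (of_nat N - 2 * of_nat j) * (-1)^j * z ^ (N - j)"
      using j unfolding g_def power_minus[of z] s2 by (simp add: of_nat_diff algebra_simps)
    have g1: "g j = (of_nat N - of_nat j) * (of_nat N - 2 * of_nat j) * (-1)^j * z^j"
      unfolding g_def power_minus[of z] by simp
    have "1 - 2 * ((of_nat j - 1) / (of_nat N - 2)) = (of_nat N - 2 * of_nat j) / (of_nat N - 2 :: complex)"
      using N1 by (simp add: field_simps)
    then show ?thesis unfolding m[symmetric] g1 g2 s1 C_def using N1 by (simp add: divide_simps) (simp add: algebra_simps)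
  qed
  have "F N z = (\<Sum>j = 1..m. - (g j + g (2 * m + 1 - j)) / C)"
    unfolding F_def using m by (intro sum.cong summand) auto
  also have "\<dots> = - (\<Sum>k = 1..2 * m. g k) / C"
    unfolding sum_pair_reflect[symmetric] by (simp only: sum_negf[symmetric] sum_divide_distrib)
  also have "(\<Sum>k = 1..2 * m. g k) = (\<Sum>k<N. g k) - g 0"
  proof -
    have "{..<N} = insert 0 {1..2 * m}" using m by auto
    then show ?thesis by simp
  qed
  finally show ?thesis unfolding C_def g_def by (simp add: power2_eq_square)
qed

theorem theorem8:
  fixes N :: nat
  assumes "N \<ge> 3" and "odd N"
  shows "inj_on (F N) (ball 0 1)"
proof (rule inj_onI)
  fix z w :: complex
  assume zw: "z \<in> ball 0 1" "w \<in> ball 0 1" "F N z = F N w"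
  have "(of_nat N - 1) * (of_nat N - 2) \<noteq> (0::complex)"
    using assms of_nat_eq_iff[where 'a = complex, of N 1] of_nat_eq_iff[where 'a = complex, of N 2] by auto
  \<comment> \<open>\<open>F\<close> is an affine function of the sum at \<open>- z\<close> with
    nonzero slope, and the disk is symmetric under negation.\<close>
  with zw(3) have "(\<Sum>k<N. (of_nat N - of_nat k) * (of_nat N - 2 * of_nat k) * (- z)^k)
      = (\<Sum>k<N. (of_nat N - of_nat k) * (of_nat N - 2 * of_nat k) * (- w)^k)"
    by (simp add: F_eq_antisym_sum[OF assms])
  from inj_onD[OF inj_on_antisym_sum[OF assms(1)] this] zw show "z = w" by simp
qed

end
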